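(* There exist parameters $\theta=(\theta_1,\theta_2,\theta_3,\theta_4)$ and an algebraic function $y(t)$ which is a solution of the sixth Painlevé equation with parameters $\theta$, such that $\theta$ lies on none of the reflecting hyperplanes of Okamoto's affine $F_4$ action (and hence on none of the reflecting hyperplanes of Okamoto's affine $D_4$ action); that is, $(\alpha,\theta)\notin\mathbb Z$ for every root $\alpha\in F_4$.
   Context: The sixth Painlevé equation with parameters $\theta=(\theta_1,\theta_2,\theta_3,\theta_4)$ is $$\frac{d^2y}{dt^2}=\frac12\Big(\frac1y+\frac1{y-1}+\frac1{y-t}\Big)\Big(\frac{dy}{dt}\Big)^2-\Big(\frac1t+\frac1{t-1}+\frac1{y-t}\Big)\frac{dy}{dt}+\frac{y(y-1)(y-t)}{t^2(t-1)^2}\Big(\alpha+\beta\frac{t}{y^2}+\gamma\frac{t-1}{(y-1)^2}+\delta\frac{t(t-1)}{(y-t)^2}\Big)$$ with $\alpha=(\theta_4-1)^2/2$, $\beta=-\theta_1^2/2$, $\gamma=\theta_3^2/2$, $\delta=(1-\theta_2^2)/2$. A solution is algebraic if $F(y(t),t)=0$ for some nonzero polynomial $F$ in two variables (equivalently, $y$ and $t$ are given by rational functions on a compact Riemann surface, $t$ nonconstant, with $y$ satisfying the equation as a function of $t$). Let $\varepsilon_1,\dots,\varepsilon_4$ be the standard orthonormal basis of $\mathbb R^4$, with inner product $(\cdot,\cdot)$. The $F_4$ root system is $F_4=\{\pm\varepsilon_i,\ \pm\varepsilon_i\pm\varepsilon_j\ (i<j),\ \tfrac12(\pm\varepsilon_1\pm\varepsilon_2\pm\varepsilon_3\pm\varepsilon_4)\}$.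 Okamoto's affine $F_4$ action on $\mathrm{P}_{\mathrm{VI}}$ acts on the parameters $\theta=\sum\theta_i\varepsilon_i$ by the standard affine Weyl group $W_a(F_4)$, whose reflecting hyperplanes are $\{\theta:(\alpha,\theta)=k\}$, $\alpha\in F_4$, $k\in\mathbb Z$. Okamoto's affine $D_4$ action is the subgroup whose reflecting hyperplanes are those with $\alpha$ one of the $24$ short roots $\pm\varepsilon_i,\ \tfrac12(\pm\varepsilon_1\pm\varepsilon_2\pm\varepsilon_3\pm\varepsilon_4)$. *)

theory Defs
  imports "HOL-Complex_Analysis.Complex_Analysis" "HOL-Computational_Algebra.Polynomial"
begin

definition PVI_rhs ::
  "complex \<Rightarrow> complex \<Rightarrow> complex \<Rightarrow> complex \<Rightarrow> complex \<Rightarrow> complex \<Rightarrow> complex \<Rightarrow> complex" where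
  "PVI_rhs \<alpha> \<beta> \<gamma> \<delta> t y y' =
     1/2 * (1/y + 1/(y - 1) + 1/(y - t)) * y'^2
     - (1/t + 1/(t - 1) + 1/(y - t)) * y'
     + y * (y - 1) * (y - t) / (t^2 * (t - 1)^2)
       * (\<alpha> + \<beta> * (t / y^2) + \<gamma> * ((t - 1) / (y - 1)^2) + \<delta> * (t * (t - 1) / (y - t)^2))"

text \<open>
  A solution is a holomorphic branch on a domain \<open>D\<close> on which no denominator of the equation
  vanishes. These conditions must be explicit because division by zero is total. The indices of
  \<^typ>\<open>real^4\<close> are taken modulo 4, so that \<open>\<theta> $ 4\<close> and \<open>\<theta> $ 0\<close> are the same component.
\<close>

definition PVI_solution_on :: "real^4 \<Rightarrow> complex set \<Rightarrow> (complex \<Rightarrow> complex) \<Rightarrow> bool" where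
  "PVI_solution_on \<theta> D y \<longleftrightarrow>
     open D \<and> connected D \<and> D \<noteq> {} \<and> y holomorphic_on D \<and>
     (\<forall>t\<in>D. t \<noteq> 0 \<and> t \<noteq> 1 \<and> y t \<noteq> 0 \<and> y t \<noteq> 1 \<and> y t \<noteq> t \<and>
        deriv (deriv y) t =
          PVI_rhs (of_real ((\<theta> $ 4 - 1)^2 / 2)) (of_real (- ((\<theta> $ 1)^2) / 2))
                  (of_real ((\<theta> $ 3)^2 / 2)) (of_real ((1 - (\<theta> $ 2)^2) / 2))
                  t (y t) (deriv y t))"

text \<open>
  \<open>F\<close> is a polynomial in \<open>y\<close> whose coefficients are polynomials in \<open>t\<close>. Substituting the constant
  polynomial \<open>[:y t:]\<close> and then evaluating at \<open>t\<close> yields \<open>F(y(t), t)\<close>.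
\<close>

definition algebraic_function_on :: "complex set \<Rightarrow> (complex \<Rightarrow> complex) \<Rightarrow> bool" where
  "algebraic_function_on D y \<longleftrightarrow>
     (\<exists>F :: complex poly poly. F \<noteq> 0 \<and> (\<forall>t\<in>D. poly (poly F [:y t:]) t = 0))"

definition F4_short_roots :: "(real^4) set" where
  "F4_short_roots =
     {s *\<^sub>R axis i 1 | s i. s \<in> {1, -1}} \<union> {v. \<forall>i. v $ i \<in> {1/2, -1/2}}"

definition F4_long_roots :: "(real^4) set" where
  "F4_long_roots =
     {r *\<^sub>R axis i 1 + s *\<^sub>R axis j 1 | r s i j. r \<in> {1, -1} \<and> s \<in> {1, -1} \<and> i \<noteq> j}"

definition F4_roots :: "(real^4) set" where
  "F4_roots = F4_short_roots \<union> F4_long_roots"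

definition root_hyperplane :: "real^4 \<Rightarrow> int \<Rightarrow> (real^4) set" where
  "root_hyperplane \<alpha> k = {\<theta>. \<alpha> \<bullet> \<theta> = of_int k}"

definition affine_F4_hyperplanes :: "(real^4) set set" where
  "affine_F4_hyperplanes = {root_hyperplane \<alpha> k | \<alpha> k. \<alpha> \<in> F4_roots}"

text \<open>
  The 24 short roots of \<open>F4\<close> form a root system of type \<open>D4\<close>. It is this one, rather than the long
  roots, that gives the action of affine \<open>D4\<close> in the coordinates \<open>\<theta>\<close>.
\<close>

definition affine_D4_hyperplanes :: "(real^4) set set" where
  "affine_D4_hyperplanes = {root_hyperplane \<alpha> k | \<alpha> k. \<alpha> \<in> F4_short_roots}"

end

theory Submission
  imports Defs
begin

text \<open>
  The witness is Boalch's icosahedral solution with 12 branches and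
  \<open>\<theta> = (2/5, 1/2, 1/3, 4/5)\<close>, parametrized rationally by
  \<open>t = 27 s\<^sup>5 (s\<^sup>2 + 1)\<^sup>2 (3 s - 4)\<^sup>3 / (4 (2 s - 1)\<^sup>3 (9 s\<^sup>2 + 4)\<^sup>2)\<close> and
  \<open>y = - 9 s (s\<^sup>2 + 1) (3 s - 4) (15 s\<^sup>4 - 5 s\<^sup>3 + 3 s\<^sup>2 - 3 s + 2)
    / ((2 s - 1)\<^sup>2 (9 s\<^sup>2 + 4) (9 s\<^sup>2 + 3 s + 10))\<close>.
  Near a point with \<open>dt/ds \<noteq> 0\<close> the map \<open>t\<close> has a holomorphic inverse, so \<open>y\<close> becomes a
  function of \<open>t\<close> whose derivatives are rational functions of \<open>s\<close>. Since \<open>t\<close>, \<open>t - 1\<close>, \<open>y\<close>,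
  \<open>y - 1\<close>, \<open>y - t\<close>, \<open>dt/ds\<close> and \<open>dy/dt\<close> all factor over a few small polynomials, the equation
  reduces to one polynomial identity in \<open>s\<close>. A polynomial relation between \<open>t\<close> and \<open>y\<close> exists
  by counting dimensions. The scalar products with the roots are excluded from \<open>\<int>\<close> by
  divisibility modulo 30 and parity.
\<close>

section \<open>Functions given by a rational parametrization\<close>

text \<open>\<open>T\<close> is injective near \<open>s0\<close> because \<open>T' s0\<close> is
  nonzero, and \<open>y\<close> is \<open>Y\<close> composed with the local inverse of
  \<open>T\<close>. Writing the \<open>s\<close>-derivatives as \<open>P s * T' s\<close> and
  \<open>Q s * T' s\<close> makes \<open>P\<close> and \<open>Q\<close> the first two derivatives
  with respect to \<open>t\<close>.\<close>

lemma local_parametrization: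
  fixes T Y T' P Q :: "complex \<Rightarrow> complex"
  assumes "open U" "s0 \<in> U"
    and T: "\<And>s. s \<in> U \<Longrightarrow> (T has_field_derivative T' s) (at s)"
    and Y: "\<And>s. s \<in> U \<Longrightarrow> (Y has_field_derivative P s * T' s) (at s)"
    and P: "\<And>s. s \<in> U \<Longrightarrow> (P has_field_derivative Q s * T' s) (at s)"
    and T'_nonzero: "\<And>s. s \<in> U \<Longrightarrow> T' s \<noteq> 0"
  obtains D y where "open D" "connected D" "D \<noteq> {}" "y holomorphic_on D"
    "\<And>t. t \<in> D \<Longrightarrow> \<exists>s\<in>U. t = T s \<and> y t = Y s \<and> deriv y t = P s \<and> deriv (deriv y) t = Q s"
proof -
  have derivT: "deriv T s = T' s" if "s \<in> U" for s
    using T[OF that] by (rule DERIV_imp_deriv)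
  have holT: "T holomorphic_on U"
    using T \<open>open U\<close> by (auto simp: holomorphic_on_open)
  obtain \<rho> where "\<rho> > 0" and sub: "ball s0 \<rho> \<subseteq> U" and inj: "inj_on T (ball s0 \<rho>)"
    using has_complex_derivative_locally_injective[OF holT \<open>s0 \<in> U\<close> \<open>open U\<close>]
      derivT[OF \<open>s0 \<in> U\<close>] T'_nonzero[OF \<open>s0 \<in> U\<close>] by metis
  define D where "D = T ` ball s0 \<rho>"
  have holT': "T holomorphic_on ball s0 \<rho>"
    using holT sub by (rule holomorphic_on_subset)
  obtain g where holg: "g holomorphic_on D"
    and g': "\<And>z. z \<in> ball s0 \<rho> \<Longrightarrow> deriv T z * deriv g (T z) = 1"
    and gT: "\<And>z. z \<in> ball s0 \<rho> \<Longrightarrow> g (T z) = z"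
    using holomorphic_has_inverse[OF holT' open_ball inj] unfolding D_def by metis
  have openD: "open D"
    unfolding D_def by (rule open_mapping_thm3[OF holT' open_ball inj])
  have "connected D"
    unfolding D_def using holT'
    by (intro connected_continuous_image holomorphic_on_imp_continuous_on) auto
  have "D \<noteq> {}"
    using \<open>\<rho> > 0\<close> by (auto simp: D_def)
  \<comment> \<open>Used twice, with \<open>Y\<close>, \<open>P\<close> and with \<open>P\<close>,
    \<open>Q\<close>: the factor \<open>T'\<close> cancels against the derivative of the inverse
    \<open>g\<close>.\<close>
  have chain: "((\<lambda>t. G (g t)) has_field_derivative G' (g t)) (at t)"
    if "t \<in> D" and G: "\<And>s. s \<in> U \<Longrightarrow> (G has_field_derivative G' s * T' s) (at s)" for G G' t
  proof -
    obtain s where s: "s \<in> ball s0 \<rho>" "t = T s" using \<open>t \<in> D\<close> by (auto simp: D_def)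
    then have "s \<in> U" using sub by auto
    have "(g has_field_derivative deriv g t) (at t)"
      using holg openD \<open>t \<in> D\<close> holomorphic_derivI by blast
    moreover have "(G has_field_derivative G' s * T' s) (at (g t))"
      using G[OF \<open>s \<in> U\<close>] gT s by simp
    ultimately have "((\<lambda>t. G (g t)) has_field_derivative G' s * T' s * deriv g t) (at t)"
      by (rule DERIV_chain2[rotated])
    moreover have "T' s * deriv g t = 1"
      using g'[OF s(1)] s(2) derivT[OF \<open>s \<in> U\<close>] by simp
    ultimately show ?thesis
      using gT s by (simp add: mult.assoc)
  qed
  have derivY: "deriv (\<lambda>t. Y (g t)) t = P (g t)" if "t \<in> D" for t
    using chain[OF that Y] by (rule DERIV_imp_deriv)
  have "deriv (deriv (\<lambda>t. Y (g t))) t = Q (g t)" if "t \<in> D" for t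
  proof -
    \<comment> \<open>Differentiating again needs the formula for the first derivative on a whole
      neighbourhood of \<open>t\<close>, which openness of \<open>D\<close> provides.\<close>
    have "deriv (deriv (\<lambda>t. Y (g t))) t = deriv (\<lambda>t. P (g t)) t"
      using eventually_nhds_in_open[OF openD that] by (intro deriv_cong_ev)
        (auto elim: eventually_mono simp: derivY)
    with chain[OF that P] show ?thesis by (simp add: DERIV_imp_deriv)
  qed
  moreover have "(\<lambda>t. Y (g t)) holomorphic_on D"
    using chain[OF _ Y] openD by (auto simp: holomorphic_on_open)
  moreover have "g t \<in> U" "t = T (g t)" if "t \<in> D" for t
    using that sub gT by (auto simp: D_def)
  ultimately show ?thesis
    using that[OF openD \<open>connected D\<close> \<open>D \<noteq> {}\<close>] derivY by metis
qed

section \<open>Algebraic dependence of two rational functions of one variable\<close>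

text \<open>The \<open>n + 1\<close> monomials span all polynomials of degree at most
  \<open>n\<close>. The relation is over indices, so repeated members of the family count
  separately; linear dependence of the image set would not see them.\<close>

lemma bounded_degree_polys_dependent:
  fixes f :: "'i \<Rightarrow> 'a::field poly"
  assumes "finite I" "card I > Suc n" "\<And>i. i \<in> I \<Longrightarrow> degree (f i) \<le> n"
  obtains k i where "i \<in> I" "k i \<noteq> 0" "(\<Sum>i\<in>I. smult (k i) (f i)) = 0"
proof -
  interpret P: vector_space "smult :: 'a \<Rightarrow> 'a poly \<Rightarrow> 'a poly"
    by unfold_locales (auto simp: smult_add_left smult_add_right)
  show ?thesis
  proof (cases "inj_on f I")
    case False
    then obtain i j where ij: "i \<in> I" "j \<in> I" "i \<noteq> j" "f i = f j"
      by (auto simp: inj_on_def)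
    define k where "k l = (if l = i then 1 else if l = j then - 1 else 0 :: 'a)" for l
    have "(\<Sum>l\<in>I. smult (k l) (f l)) = (\<Sum>l\<in>{i, j}. smult (k l) (f l))"
      using \<open>finite I\<close> ij by (intro sum.mono_neutral_right) (auto simp: k_def)
    also have "\<dots> = 0" using ij by (simp add: k_def)
    finally show ?thesis using that[of i k] ij by (simp add: k_def)
  next
    case True
    have "f ` I \<subseteq> P.span (monom 1 ` {..n})"
    proof clarify
      fix i assume "i \<in> I"
      have "f i = (\<Sum>m\<le>n. smult (coeff (f i) m) (monom 1 m))"
        using poly_as_sum_of_monoms'[OF assms(3)[OF \<open>i \<in> I\<close>]] by (simp add: smult_monom)
      also have "\<dots> \<in> P.span (monom 1 ` {..n})"
        by (intro P.span_sum P.span_scale P.span_base) auto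
      finally show "f i \<in> P.span (monom 1 ` {..n})" .
    qed
    moreover have "card (f ` I) > card (monom (1::'a) ` {..n})"
      using card_image_le[of "{..n}" "monom (1::'a)"] assms(2) card_image[OF True] by simp
    ultimately have "P.dependent (f ` I)"
      using P.independent_span_bound[of "monom 1 ` {..n}" "f ` I"] by fastforce
    then obtain u where u: "\<exists>v\<in>f ` I. u v \<noteq> 0" "(\<Sum>v\<in>f ` I. smult (u v) v) = 0"
      using P.dependent_finite[of "f ` I"] \<open>finite I\<close> by auto
    have "(\<Sum>i\<in>I. smult (u (f i)) (f i)) = 0"
      using u(2) by (simp add: sum.reindex[OF True])
    then show ?thesis using u(1) that[of _ "u \<circ> f"] by auto
  qed
qed

lemma rational_functions_algebraically_dependent:
  fixes n1 d1 n2 d2 :: "'a::field poly"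
  obtains F :: "'a poly poly" where "F \<noteq> 0"
    "\<And>s. poly d1 s \<noteq> 0 \<Longrightarrow> poly d2 s \<noteq> 0 \<Longrightarrow>
       poly (poly F [:poly n2 s / poly d2 s:]) (poly n1 s / poly d1 s) = 0"
proof -
  \<comment> \<open>The \<open>(N + 1)\<^sup>2\<close> monomials of degree at most \<open>N\<close> in each variable, with denominators cleared,
    are polynomials of degree at most \<open>N\<^sup>2\<close>, so they are linearly dependent.\<close>
  define N where "N = Suc (degree n1 + degree d1 + degree n2 + degree d2)"
  define I where "I = {..N} \<times> {..N}"
  define f where "f = (\<lambda>(i, j). n1 ^ i * d1 ^ (N - i) * (n2 ^ j * d2 ^ (N - j)))"
  have homogeneous_degree: "degree (p ^ i * q ^ (N - i)) \<le> N * (degree p + degree q)"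
    if "i \<le> N" for p q :: "'a poly" and i
  proof -
    have "degree (p ^ i * q ^ (N - i)) \<le> i * degree p + (N - i) * degree q"
      using degree_mult_le[of "p ^ i" "q ^ (N - i)"] degree_power_le[of p i] degree_power_le[of q "N - i"]
      by (simp add: mult.commute)
    also have "\<dots> \<le> N * degree p + N * degree q"
      using that by (intro add_mono mult_right_mono) auto
    finally show ?thesis by (simp add: algebra_simps)
  qed
  have "degree (f x) \<le> N * N" if xI: "x \<in> I" for x
  proof -
    obtain i j where x: "x = (i, j)" "i \<le> N" "j \<le> N" using xI by (auto simp: I_def)
    have "degree (f x) \<le> N * (degree n1 + degree d1) + N * (degree n2 + degree d2)"
      using degree_mult_le[of "n1 ^ i * d1 ^ (N - i)" "n2 ^ j * d2 ^ (N - j)"]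
        homogeneous_degree[OF x(2), of n1 d1] homogeneous_degree[OF x(3), of n2 d2] x(1) by (simp add: f_def)
    also have "\<dots> = N * (degree n1 + degree d1 + degree n2 + degree d2)" by (simp add: algebra_simps)
    also have "\<dots> \<le> N * N" by (intro mult_left_mono) (auto simp: N_def)
    finally show ?thesis .
  qed
  \<comment> \<open>\<open>(N + 1)^2 > N^2 + 1\<close> because the \<open>Suc\<close> in
    \<open>N\<close> makes it positive.\<close>
  then obtain k x where x: "x \<in> I" "k x \<noteq> 0" and dep: "(\<Sum>x\<in>I. smult (k x) (f x)) = 0"
    by (rule bounded_degree_polys_dependent[rotated 2]) (auto simp: I_def N_def)
  define F where "F = (\<Sum>(i, j)\<in>I. monom (monom (k (i, j)) i) j)"
  \<comment> \<open>Distinct index pairs give distinct monomials, so nothing cancels in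
    \<open>F\<close>.\<close>
  have "coeff (coeff F j) i = k (i, j)" if "(i, j) \<in> I" for i j
  proof -
    have "coeff (coeff F j) i = (\<Sum>y\<in>I. if y = (i, j) then k y else 0)"
      unfolding F_def coeff_sum
      by (intro sum.cong) (auto simp: coeff_monom split: if_splits)
    also have "\<dots> = k (i, j)" using that by (simp add: I_def)
    finally show ?thesis .
  qed
  then have "F \<noteq> 0" using x by (cases x) force
  moreover have "poly (poly F [:poly n2 s / poly d2 s:]) (poly n1 s / poly d1 s) = 0"
    if nz: "poly d1 s \<noteq> 0" "poly d2 s \<noteq> 0" for s
  proof -
    have "poly (poly F [:poly n2 s / poly d2 s:]) (poly n1 s / poly d1 s) =
        (\<Sum>(i, j)\<in>I. k (i, j) * (poly n1 s / poly d1 s) ^ i * (poly n2 s / poly d2 s) ^ j)"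
      unfolding F_def poly_sum by (intro sum.cong) (auto simp: poly_monom)
    also have "\<dots> = (\<Sum>x\<in>I. poly (smult (k x) (f x)) s / (poly d1 s ^ N * poly d2 s ^ N))"
      using nz by (intro sum.cong) (auto simp: f_def I_def power_divide power_diff field_simps)
    also have "\<dots> = poly (\<Sum>x\<in>I. smult (k x) (f x)) s / (poly d1 s ^ N * poly d2 s ^ N)"
      by (simp only: poly_sum sum_divide_distrib)
    finally show ?thesis using dep by simp
  qed
  ultimately show ?thesis using that by blast
qed

section \<open>The icosahedral solution\<close>

text \<open>
  \<open>pf\<close>, \<open>pg\<close>, \<open>ph\<close> are the irreducible factors of the numerator of \<open>t - 1\<close> (with \<open>ph\<close> a product
  of two), \<open>pr\<close> and \<open>pu\<close> are the remaining factors of \<open>y - 1\<close> and \<open>y - t\<close>, and \<open>pv\<close>, \<open>pw\<close> are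
  the nontrivial factors of \<open>dy/dt\<close> and \<open>d\<^sup>2y/dt\<^sup>2\<close>. The form of \<open>pw\<close> is what the product rule
  yields when it is applied to \<open>dydt\<close> below.
\<close>

definition pa :: "complex \<Rightarrow> complex" where "pa s = s^2 + 1"
definition pb :: "complex \<Rightarrow> complex" where "pb s = 3 * s - 4"
definition pc :: "complex \<Rightarrow> complex" where "pc s = 2 * s - 1"
definition pd :: "complex \<Rightarrow> complex" where "pd s = 9 * s^2 + 4"
definition pe :: "complex \<Rightarrow> complex" where "pe s = 9 * s^2 + 3 * s + 10"
definition pf :: "complex \<Rightarrow> complex" where "pf s = 3 * s^2 - 3 * s + 2"
definition pg :: "complex \<Rightarrow> complex" where "pg s = 3 * s^2 + 2 * s + 2"
definition ph :: "complex \<Rightarrow> complex" where "ph s = (s - 2) * (3 * s - 1)"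
definition pq :: "complex \<Rightarrow> complex" where "pq s = 15 * s^4 - 5 * s^3 + 3 * s^2 - 3 * s + 2"
definition pr :: "complex \<Rightarrow> complex" where
  "pr s = 9 * s^4 - 12 * s^3 + 12 * s^2 - 10 * s + 2"
definition pu :: "complex \<Rightarrow> complex" where
  "pu s = 27 * s^6 - 54 * s^5 + 45 * s^4 + 50 * s^3 - 30 * s^2 + 24 * s - 8"
definition pv :: "complex \<Rightarrow> complex" where
  "pv s = 1458 * s^12 - 1944 * s^11 + 4941 * s^10 - 6966 * s^9 + 8172 * s^8 - 7842 * s^7
     + 5977 * s^6 - 3312 * s^5 + 1988 * s^4 - 396 * s^3 + 264 * s^2 - 80 * s + 32"
definition pv' :: "complex \<Rightarrow> complex" where
  "pv' s = 17496 * s^11 - 21384 * s^10 + 49410 * s^9 - 62694 * s^8 + 65376 * s^7 - 54894 * s^6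
     + 35862 * s^5 - 16560 * s^4 + 7952 * s^3 - 1188 * s^2 + 528 * s - 80"
definition pw :: "complex \<Rightarrow> complex" where
  "pw s = s * pa s * pb s * pe s * pf s * pg s
       * (2 * pd s * pv s + 18 * s * pc s * pv s + pc s * pd s * pv' s)
     - pc s * pd s * pv s *
       (4 * pa s * pb s * pe s * pf s * pg s
        + 2 * s^2 * pb s * pe s * pf s * pg s
        + 6 * s * pa s * pe s * pf s * pg s
        + 2 * s * pa s * pb s * (18 * s + 3) * pf s * pg s
        + 2 * s * pa s * pb s * pe s * (6 * s - 3) * pg s
        + s * pa s * pb s * pe s * pf s * (6 * s + 2))"

lemmas factor_defs = pa_def pb_def pc_def pd_def pe_def pf_def pg_def ph_def pq_def pr_def pu_def

definition t_par :: "complex \<Rightarrow> complex" where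
  "t_par s = 27 * s^5 * (pa s)^2 * (pb s)^3 / (4 * (pc s)^3 * (pd s)^2)"
definition y_par :: "complex \<Rightarrow> complex" where
  "y_par s = - 9 * s * pa s * pb s * pq s / ((pc s)^2 * pd s * pe s)"
text \<open>The map \<open>t\<close> has degree 12 and critical values only 0, 1 and infinity, so
  \<open>dt/ds\<close> consists of the factors of \<open>t\<close> and \<open>t - 1\<close>, with
  zero orders lowered and pole orders raised by one.\<close>

definition t_par' :: "complex \<Rightarrow> complex" where
  "t_par' s = 135 * s^4 * pa s * (pb s)^2 * (pf s)^2 * pg s / (2 * (pc s)^4 * (pd s)^3)"
definition dydt :: "complex \<Rightarrow> complex" where
  "dydt s = - 4 * pc s * pd s * pv s / (3 * s^4 * pa s * (pb s)^2 * (pe s)^2 * (pf s)^2 * pg s)"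
definition d2ydt2 :: "complex \<Rightarrow> complex" where
  "d2ydt2 s = - 8 * (pc s)^4 * (pd s)^3 * pw s
     / (405 * s^9 * (pa s)^3 * (pb s)^5 * (pe s)^3 * (pf s)^5 * (pg s)^3)"

text \<open>Here no denominator vanishes, \<open>dt/ds\<close> is nonzero, \<open>t\<close> avoids 0
  and 1, and \<open>y\<close> avoids 0, 1 and \<open>t\<close>. The factors \<open>pq\<close> and
  \<open>pv\<close> also make the logarithmic derivatives of \<open>y\<close> and
  \<open>dy/dt\<close> meaningful.\<close>

definition regular :: "complex set" where
  "regular = {s. s * pa s * pb s * pc s * pd s * pe s * pf s * pg s * ph s * pq s * pr s * pu s * pv s \<noteq> 0}"

section \<open>Derivatives along the parametrization\<close>

lemma factor_derivs:
  "(pa has_field_derivative 2 * s) (at s)"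
  "(pb has_field_derivative 3) (at s)"
  "(pc has_field_derivative 2) (at s)"
  "(pd has_field_derivative 18 * s) (at s)"
  "(pe has_field_derivative 18 * s + 3) (at s)"
  "(pf has_field_derivative 6 * s - 3) (at s)"
  "(pg has_field_derivative 6 * s + 2) (at s)"
  "(pq has_field_derivative 60 * s^3 - 15 * s^2 + 6 * s - 3) (at s)"
  "(pv has_field_derivative pv' s) (at s)"
  unfolding pa_def [abs_def] pb_def [abs_def] pc_def [abs_def] pd_def [abs_def] pe_def [abs_def]
    pf_def [abs_def] pg_def [abs_def] pq_def [abs_def] pv_def [abs_def] pv'_def
  by (rule derivative_eq_intros refl | simp)+

text \<open>With every derivative in the form \<open>f s * l\<close>, the logarithmic derivative
  \<open>l\<close> is additive over products and quotients and scales under powers. Factored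
  expressions can then be differentiated without being expanded.\<close>

lemma
  fixes f g :: "'a::real_normed_field \<Rightarrow> 'a"
  shows log_deriv_base: "(f has_field_derivative f') (at s) \<Longrightarrow> f s \<noteq> 0 \<Longrightarrow>
      (f has_field_derivative f s * (f' / f s)) (at s)"
    and log_deriv_const: "((\<lambda>_. k) has_field_derivative k * 0) (at s)"
    and log_deriv_mult: "(f has_field_derivative f s * l) (at s) \<Longrightarrow> (g has_field_derivative g s * m) (at s) \<Longrightarrow>
      ((\<lambda>s. f s * g s) has_field_derivative f s * g s * (l + m)) (at s)"
    and log_deriv_divide: "(f has_field_derivative f s * l) (at s) \<Longrightarrow> (g has_field_derivative g s * m) (at s) \<Longrightarrow>
      g s \<noteq> 0 \<Longrightarrow> ((\<lambda>s. f s / g s) has_field_derivative f s / g s * (l - m)) (at s)"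
    and log_deriv_power: "(f has_field_derivative f s * l) (at s) \<Longrightarrow>
      ((\<lambda>s. f s ^ n) has_field_derivative f s ^ n * (of_nat n * l)) (at s)"
proof -
  show "(f has_field_derivative f s * (f' / f s)) (at s)"
    if "(f has_field_derivative f') (at s)" "f s \<noteq> 0" using that by simp
  show "((\<lambda>_. k) has_field_derivative k * 0) (at s)" by simp
  show "((\<lambda>s. f s * g s) has_field_derivative f s * g s * (l + m)) (at s)"
    if "(f has_field_derivative f s * l) (at s)" "(g has_field_derivative g s * m) (at s)"
    using DERIV_mult[OF that] by (simp add: algebra_simps)
  show "((\<lambda>s. f s / g s) has_field_derivative f s / g s * (l - m)) (at s)"
    if "(f has_field_derivative f s * l) (at s)" "(g has_field_derivative g s * m) (at s)" "g s \<noteq> 0"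
    using DERIV_divide[OF that] that(3) by (simp add: right_diff_distrib diff_divide_distrib mult_ac)
  show "((\<lambda>s. f s ^ n) has_field_derivative f s ^ n * (of_nat n * l)) (at s)"
    if "(f has_field_derivative f s * l) (at s)"
    using DERIV_power[OF that, of n] by (cases n) (simp_all add: algebra_simps)
qed

lemmas log_deriv_intros = log_deriv_mult log_deriv_divide log_deriv_power log_deriv_const

lemma t_par_deriv:
  assumes "s \<in> regular"
  shows "(t_par has_field_derivative t_par' s) (at s)"
proof -
  have nz: "s \<noteq> 0" "pa s \<noteq> 0" "pb s \<noteq> 0" "pc s \<noteq> 0" "pd s \<noteq> 0"
    using assms by (auto simp: regular_def)
  have "(t_par has_field_derivative
      t_par s * (5 / s + 4 * s / pa s + 9 / pb s - 6 / pc s - 36 * s / pd s)) (at s)"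
    unfolding t_par_def [abs_def]
    by (rule DERIV_cong, (rule log_deriv_intros factor_derivs[THEN log_deriv_base]
          log_deriv_base[OF DERIV_ident] nz)+) (use nz in simp_all)
  \<comment> \<open>The logarithmic derivative of \<open>t\<close> over its common denominator. The
    factors on the right come from the triple zeros of \<open>t - 1\<close> at the roots of
    \<open>pf\<close> and the double ones at those of \<open>pg\<close>.\<close>
  moreover have "5 * pa s * pb s * pc s * pd s + 4 * s^2 * pb s * pc s * pd s + 9 * s * pa s * pc s * pd s
      - 6 * s * pa s * pb s * pd s - 36 * s^2 * pa s * pb s * pc s = 10 * (pf s)^2 * pg s"
    unfolding factor_defs by algebra
  then have "t_par s * (5 / s + 4 * s / pa s + 9 / pb s - 6 / pc s - 36 * s / pd s) = t_par' s"
    unfolding t_par_def t_par'_def using nz by (simp add: divide_simps) algebra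
  ultimately show ?thesis by simp
qed

lemma y_par_deriv:
  assumes "s \<in> regular"
  shows "(y_par has_field_derivative dydt s * t_par' s) (at s)"
proof -
  have nz: "s \<noteq> 0" "pa s \<noteq> 0" "pb s \<noteq> 0" "pc s \<noteq> 0" "pd s \<noteq> 0" "pe s \<noteq> 0"
      "pf s \<noteq> 0" "pg s \<noteq> 0" "pq s \<noteq> 0"
    using assms by (auto simp: regular_def)
  let ?q' = "60 * s^3 - 15 * s^2 + 6 * s - 3"
  let ?L = "1 / s + 2 * s / pa s + 3 / pb s + ?q' / pq s - 4 / pc s - 18 * s / pd s - (18 * s + 3) / pe s"
  have "(y_par has_field_derivative y_par s * ?L) (at s)"
    unfolding y_par_def [abs_def]
    by (rule DERIV_cong, (rule log_deriv_intros factor_derivs[THEN log_deriv_base]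
          log_deriv_base[OF DERIV_ident] nz)+) (use nz in simp_all)
  \<comment> \<open>This is where \<open>pv\<close> comes from: up to the factor 10 it is the
    numerator of the logarithmic derivative of \<open>y\<close> over the common denominator.\<close>
  moreover have "pa s * pb s * pq s * pc s * pd s * pe s + 2 * s^2 * pb s * pq s * pc s * pd s * pe s
      + 3 * s * pa s * pq s * pc s * pd s * pe s
      + s * pa s * pb s * ?q' * pc s * pd s * pe s
      - 4 * s * pa s * pb s * pq s * pd s * pe s - 18 * s^2 * pa s * pb s * pq s * pc s * pe s
      - s * pa s * pb s * pq s * pc s * pd s * (18 * s + 3) = 10 * pv s" (is "?K = _")
    unfolding factor_defs pv_def by algebra
  moreover have "- 9 * (10 * pv s) / ((pc s)^3 * (pd s)^2 * (pe s)^2) = dydt s * t_par' s"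
    unfolding dydt_def t_par'_def using nz
    by (simp add: divide_simps) (simp add: eval_nat_numeral mult_ac)
  moreover have "y_par s * ?L = - 9 * ?K / ((pc s)^3 * (pd s)^2 * (pe s)^2)"
    unfolding y_par_def using nz
    by (simp add: divide_simps del: mult_eq_0_iff) algebra
  ultimately show ?thesis by (simp only:)
qed

lemma dydt_deriv:
  assumes "s \<in> regular"
  shows "(dydt has_field_derivative d2ydt2 s * t_par' s) (at s)"
proof -
  have nz: "s \<noteq> 0" "pa s \<noteq> 0" "pb s \<noteq> 0" "pc s \<noteq> 0" "pd s \<noteq> 0" "pe s \<noteq> 0"
      "pf s \<noteq> 0" "pg s \<noteq> 0" "pv s \<noteq> 0"
    using assms by (auto simp: regular_def)
  let ?L = "2 / pc s + 18 * s / pd s + pv' s / pv s - 4 / s - 2 * s / pa s - 6 / pb s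
      - 2 * (18 * s + 3) / pe s - 2 * (6 * s - 3) / pf s - (6 * s + 2) / pg s"
  have "(dydt has_field_derivative dydt s * ?L) (at s)"
    unfolding dydt_def [abs_def]
    by (rule DERIV_cong, (rule log_deriv_intros factor_derivs[THEN log_deriv_base]
          log_deriv_base[OF DERIV_ident] nz)+) (use nz in simp_all)
  moreover have "dydt s * ?L = - 4 * pw s
     / (3 * s^5 * (pa s)^2 * (pb s)^3 * (pe s)^3 * (pf s)^3 * (pg s)^2)"
    unfolding dydt_def pw_def using nz by (simp add: divide_simps) algebra
  moreover have "\<dots> = d2ydt2 s * t_par' s"
    unfolding d2ydt2_def t_par'_def using nz
    by (simp add: divide_simps) (simp add: eval_nat_numeral mult_ac)
  ultimately show ?thesis by simp
qed

section \<open>Factorizations of \<open>t - 1\<close>, \<open>y - 1\<close>, \<open>y - t\<close>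
  and verification of the equation\<close>

lemma t_par_minus_1:
  assumes "s \<in> regular"
  shows "t_par s - 1 = (pf s)^3 * (pg s)^2 * ph s / (4 * (pc s)^3 * (pd s)^2)"
proof -
  have "27 * s^5 * (pa s)^2 * (pb s)^3 - 4 * (pc s)^3 * (pd s)^2 = (pf s)^3 * (pg s)^2 * ph s"
    unfolding factor_defs by algebra
  then show ?thesis using assms by (simp add: t_par_def regular_def divide_simps)
qed

lemma y_par_minus_1:
  assumes "s \<in> regular"
  shows "y_par s - 1 = - 5 * pf s * pg s * pr s / ((pc s)^2 * pd s * pe s)"
proof -
  have "- 9 * s * pa s * pb s * pq s - (pc s)^2 * pd s * pe s = - 5 * pf s * pg s * pr s"
    unfolding factor_defs by algebra
  then show ?thesis using assms by (simp add: y_par_def regular_def divide_simps)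
qed

lemma y_par_minus_t_par:
  assumes "s \<in> regular"
  shows "y_par s - t_par s = - 9 * s * pa s * pb s * pf s * pg s * pu s / (4 * (pc s)^3 * (pd s)^2 * pe s)"
proof -
  \<comment> \<open>What remains of the numerator of \<open>y - t\<close> once the common factor
    \<open>- 9 * s * pa s * pb s\<close> is taken out.\<close>
  have "4 * pq s * pc s * pd s + 3 * s^4 * pa s * (pb s)^2 * pe s = pf s * pg s * pu s"
    unfolding factor_defs by algebra
  then show ?thesis using assms
    by (simp add: y_par_def t_par_def regular_def divide_simps) algebra
qed

text \<open>The factors are free variables, so each of the ten terms is a monomial fraction that
  simplifies by cancellation alone. The prefactor is that of \<open>d2ydt2\<close> up to sign; the
  constants are the equation's coefficients for \<theta> = (2/5, 1/2, 1/3, 4/5).\<close>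

lemma PVI_rhs_factored:
  fixes s a b c d e f g h q r u v t y p :: complex
  assumes nz: "s \<noteq> 0" "a \<noteq> 0" "b \<noteq> 0" "c \<noteq> 0" "d \<noteq> 0" "e \<noteq> 0"
      "f \<noteq> 0" "g \<noteq> 0" "h \<noteq> 0" "q \<noteq> 0" "r \<noteq> 0" "u \<noteq> 0"
    and t: "t = 27 * s^5 * a^2 * b^3 / (4 * c^3 * d^2)"
    and t1: "t - 1 = f^3 * g^2 * h / (4 * c^3 * d^2)"
    and y: "y = - 9 * s * a * b * q / (c^2 * d * e)"
    and y1: "y - 1 = - 5 * f * g * r / (c^2 * d * e)"
    and yt: "y - t = - 9 * s * a * b * f * g * u / (4 * c^3 * d^2 * e)"
    and p: "p = - 4 * c * d * v / (3 * s^4 * a * b^2 * e^2 * f^2 * g)"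
  shows "PVI_rhs (1/50) (-2/25) (1/18) (3/8) t y p =
     8 * c^4 * d^3 / (405 * s^9 * a^3 * b^5 * e^3 * f^5 * g^3) *
     ((- 5 * v^2 * f * g * r * u * h^2 + (- 9 * v^2 * s * a * b * q * u * h^2)
        + (- 20 * c * d * v^2 * q * r * h^2)
      - (- 10 * v * e * f^3 * g^2 * q * r * u * h^2 + (- 270 * v * s^5 * a^2 * b^3 * e * q * r * u * h)
        + 30 * v * s^4 * a * b^2 * e^2 * f^2 * g * q * r * h^2)
      + (- 36 * c * d * q^2 * r^2 * u^2 * s * a * b * f * g
        + 12 * c^2 * d * r^2 * u^2 * s^4 * a * b^2 * e^2 * f * g
        + (- 1 * c^2 * d * q^2 * u^2 * s * a * b * e^2 * f^2 * g * h)
        + (- 225 * c * d * q^2 * r^2 * s^4 * a * b^2 * e^2 * f^2 * g * h))) / (q * r * u * h^2))"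
    (is "_ = ?M * (_ / ?Q)")
proof -
  let ?G = "y * (y - 1) * (y - t) / (t^2 * (t - 1)^2)"
  have "1/2 * (1/y) * p^2 = ?M * (- 5 * v^2 * f * g * r * u * h^2 / ?Q)"
    \<comment> \<open>The differences are rewritten first, since replacing \<open>y\<close> and
      \<open>t\<close> would destroy their patterns.\<close>
    unfolding yt y1 t1 unfolding y t p using nz by (simp add: divide_simps eval_nat_numeral)
  moreover have "1/2 * (1/(y - 1)) * p^2 = ?M * (- 9 * v^2 * s * a * b * q * u * h^2 / ?Q)"
    unfolding yt y1 t1 unfolding y t p using nz by (simp add: divide_simps eval_nat_numeral)
  moreover have "1/2 * (1/(y - t)) * p^2 = ?M * (- 20 * c * d * v^2 * q * r * h^2 / ?Q)"
    unfolding yt y1 t1 unfolding y t p using nz by (simp add: divide_simps eval_nat_numeral)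
  moreover have "1/t * p = ?M * (- 10 * v * e * f^3 * g^2 * q * r * u * h^2 / ?Q)"
    unfolding yt y1 t1 unfolding y t p using nz by (simp add: divide_simps eval_nat_numeral)
  moreover have "1/(t - 1) * p = ?M * (- 270 * v * s^5 * a^2 * b^3 * e * q * r * u * h / ?Q)"
    unfolding yt y1 t1 unfolding y t p using nz by (simp add: divide_simps eval_nat_numeral)
  moreover have "1/(y - t) * p = ?M * (30 * v * s^4 * a * b^2 * e^2 * f^2 * g * q * r * h^2 / ?Q)"
    unfolding yt y1 t1 unfolding y t p using nz by (simp add: divide_simps eval_nat_numeral)
  moreover have "?G * (1/50) = ?M * (- 36 * c * d * q^2 * r^2 * u^2 * s * a * b * f * g / ?Q)"
    unfolding yt y1 t1 unfolding y t p using nz by (simp add: divide_simps eval_nat_numeral)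
  moreover have "?G * (-2/25 * (t / y^2)) = ?M * (12 * c^2 * d * r^2 * u^2 * s^4 * a * b^2 * e^2 * f * g / ?Q)"
    unfolding yt y1 t1 unfolding y t p using nz by (simp add: divide_simps eval_nat_numeral)
  moreover have "?G * (1/18 * ((t - 1) / (y - 1)^2)) = ?M * (- 1 * c^2 * d * q^2 * u^2 * s * a * b * e^2 * f^2 * g * h / ?Q)"
    unfolding yt y1 t1 unfolding y t p using nz by (simp add: divide_simps eval_nat_numeral)
  moreover have "?G * (3/8 * (t * (t - 1) / (y - t)^2)) = ?M * (- 225 * c * d * q^2 * r^2 * s^4 * a * b^2 * e^2 * f^2 * g * h / ?Q)"
    unfolding yt y1 t1 unfolding y t p using nz by (simp add: divide_simps eval_nat_numeral)
  moreover have "PVI_rhs (1/50) (-2/25) (1/18) (3/8) t y p =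
      1/2 * (1/y) * p^2 + 1/2 * (1/(y - 1)) * p^2 + 1/2 * (1/(y - t)) * p^2
      - (1/t * p + 1/(t - 1) * p + 1/(y - t) * p)
      + (?G * (1/50) + ?G * (-2/25 * (t / y^2)) + ?G * (1/18 * ((t - 1) / (y - 1)^2))
         + ?G * (3/8 * (t * (t - 1) / (y - t)^2)))"
    unfolding PVI_rhs_def by (simp only: distrib_left distrib_right)
  ultimately show ?thesis
    by (simp only: add_divide_distrib diff_divide_distrib distrib_left right_diff_distrib)
qed

text \<open>The polynomial identity behind the equation: the apparent poles of its right side where
  \<open>pq\<close>, \<open>pr\<close>, \<open>pu\<close> or \<open>ph\<close> vanishes, that is at
  points with \<open>y = 0\<close>, \<open>y = 1\<close>, \<open>y = t\<close> or
  \<open>t = 1\<close>, cancel and leave \<open>- pw\<close>.\<close>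

lemma d2ydt2_numerator:
  "- 5 * (pv s)^2 * pf s * pg s * pr s * pu s * (ph s)^2 + (- 9 * (pv s)^2 * s * pa s * pb s * pq s * pu s * (ph s)^2)
        + (- 20 * pc s * pd s * (pv s)^2 * pq s * pr s * (ph s)^2)
      - (- 10 * pv s * pe s * (pf s)^3 * (pg s)^2 * pq s * pr s * pu s * (ph s)^2 + (- 270 * pv s * s^5 * (pa s)^2 * (pb s)^3 * pe s * pq s * pr s * pu s * ph s)
        + 30 * pv s * s^4 * pa s * (pb s)^2 * (pe s)^2 * (pf s)^2 * pg s * pq s * pr s * (ph s)^2)
      + (- 36 * pc s * pd s * (pq s)^2 * (pr s)^2 * (pu s)^2 * s * pa s * pb s * pf s * pg s
        + 12 * (pc s)^2 * pd s * (pr s)^2 * (pu s)^2 * s^4 * pa s * (pb s)^2 * (pe s)^2 * pf s * pg s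
        + (- 1 * (pc s)^2 * pd s * (pq s)^2 * (pu s)^2 * s * pa s * pb s * (pe s)^2 * (pf s)^2 * pg s * ph s)
        + (- 225 * pc s * pd s * (pq s)^2 * (pr s)^2 * s^4 * pa s * (pb s)^2 * (pe s)^2 * (pf s)^2 * pg s * ph s))
   = - pw s * (pq s * pr s * pu s * (ph s)^2)"
  unfolding pw_def factor_defs pv_def pv'_def by algebra

lemma PVI_par:
  assumes "s \<in> regular"
  shows "d2ydt2 s = PVI_rhs (1/50) (-2/25) (1/18) (3/8) (t_par s) (y_par s) (dydt s)"
proof -
  have nz: "s \<noteq> 0" "pa s \<noteq> 0" "pb s \<noteq> 0" "pc s \<noteq> 0" "pd s \<noteq> 0" "pe s \<noteq> 0"
      "pf s \<noteq> 0" "pg s \<noteq> 0" "ph s \<noteq> 0" "pq s \<noteq> 0" "pr s \<noteq> 0" "pu s \<noteq> 0"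
    using assms by (auto simp: regular_def)
  show ?thesis
    unfolding PVI_rhs_factored[OF nz t_par_def t_par_minus_1[OF assms] y_par_def
        y_par_minus_1[OF assms] y_par_minus_t_par[OF assms] dydt_def]
      d2ydt2_numerator
    using nz by (simp add: d2ydt2_def)
qed

lemma open_regular: "open regular"
  unfolding regular_def factor_defs pv_def by (intro open_Collect_neq continuous_intros)

text \<open>The base point around which \<open>t\<close> is inverted.\<close>

lemma three_in_regular: "3 \<in> regular"
  by (simp add: regular_def factor_defs pv_def)

section \<open>The parameters\<close>

definition generic_parameters :: "real^4" where
  "generic_parameters = (\<chi> i. if i = 1 then 2/5 else if i = 2 then 1/2 else if i = 3 then 1/3 else 4/5)"

lemma generic_parameters_nth [simp]:
  "generic_parameters $ 1 = 2/5" "generic_parameters $ 2 = 1/2"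
  "generic_parameters $ 3 = 1/3" "generic_parameters $ 4 = 4/5"
  by (simp_all add: generic_parameters_def)

lemma not_Ints_if_not_multiple:
  fixes x :: real
  assumes "of_int n * x = of_int m" "\<not> n dvd m"
  shows "x \<notin> \<int>"
proof
  assume "x \<in> \<int>"
  then obtain k where "x = of_int k" by (auto elim: Ints_cases)
  with assms(1) have "(of_int (n * k) :: real) = of_int m" by simp
  then have "m = n * k" by (simp only: of_int_eq_iff)
  with assms(2) show False by simp
qed

lemma generic_parameters_off_roots:
  assumes "\<alpha> \<in> F4_roots"
  shows "\<alpha> \<bullet> generic_parameters \<notin> \<int>"
proof -
  \<comment> \<open>30 is the least common denominator of the parameters. No entry of
    \<open>k\<close>, and no sum or difference of two distinct entries, is a multiple of 30.\<close>
  define k :: "4 \<Rightarrow> int" where "k i = (if i = 1 then 12 else if i = 2 then 15 else if i = 3 then 10 else 24)" for i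
  have k: "30 * generic_parameters $ i = of_int (k i)" for i
    by (simp add: generic_parameters_def k_def)
  have k_nth: "k 1 = 12" "k 2 = 15" "k 3 = 10" "k 4 = 24"
    by (simp_all add: k_def)
  have sign: "\<exists>n \<in> {1, -1 :: int}. \<sigma> = of_int n" if "\<sigma> \<in> {1, -1}" for \<sigma> :: real
    using that by auto
  consider
      (unit) "\<exists>\<sigma>\<in>{1, -1}. \<exists>i. \<alpha> = \<sigma> *\<^sub>R axis i 1"
    | (half) "\<And>i. \<alpha> $ i \<in> {1/2, -1/2}"
    | (long) "\<exists>\<rho>\<in>{1, -1}. \<exists>\<sigma>\<in>{1, -1}. \<exists>i j. i \<noteq> j \<and> \<alpha> = \<rho> *\<^sub>R axis i 1 + \<sigma> *\<^sub>R axis j 1"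
    using assms unfolding F4_roots_def F4_short_roots_def F4_long_roots_def Un_iff mem_Collect_eq
    by metis
  then show ?thesis
  proof cases
    case unit
    then obtain \<sigma> i where unit: "\<sigma> \<in> {1, -1 :: int}" "\<alpha> = of_int \<sigma> *\<^sub>R axis i 1"
      using sign by metis
    then have "of_int 30 * (\<alpha> \<bullet> generic_parameters) = of_int (\<sigma> * k i)"
      by (auto simp: inner_axis' k)
    moreover have "\<not> 30 dvd \<sigma> * k i"
      using unit(1) exhaust_4[of i] by (auto simp: k_nth)
    ultimately show ?thesis by (rule not_Ints_if_not_multiple)
  next
    case long
    then obtain \<rho> \<sigma> i j where long: "\<rho> \<in> {1, -1 :: int}" "\<sigma> \<in> {1, -1 :: int}" "i \<noteq> j"
        "\<alpha> = of_int \<rho> *\<^sub>R axis i 1 + of_int \<sigma> *\<^sub>R axis j 1"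
      using sign by metis
    then have "of_int 30 * (\<alpha> \<bullet> generic_parameters) = of_int (\<rho> * k i + \<sigma> * k j)"
      by (simp add: inner_axis' inner_add_left k [symmetric] algebra_simps)
    moreover have "\<not> 30 dvd \<rho> * k i + \<sigma> * k j"
      using long(1-3) exhaust_4[of i] exhaust_4[of j] by (auto simp: k_nth)
    ultimately show ?thesis by (rule not_Ints_if_not_multiple)
  next
    case half
    have "\<exists>n :: int. 2 * \<alpha> $ i = of_int n \<and> odd n" for i
      using half[of i] by (auto intro: exI[of _ 1] exI[of _ "- 1"])
    then obtain n :: "4 \<Rightarrow> int" where n: "\<And>i. 2 * \<alpha> $ i = of_int (n i)" "\<And>i. odd (n i)"
      by metis
    have "of_int 60 * (\<alpha> \<bullet> generic_parameters) = (\<Sum>i\<in>UNIV. (2 * \<alpha> $ i) * (30 * generic_parameters $ i))"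
      by (simp add: inner_vec_def sum_distrib_left)
    also have "\<dots> = of_int (n 1 * 12 + n 2 * 15 + n 3 * 10 + n 4 * 24)"
      by (simp add: n k sum_4 k_nth)
    finally have "of_int 60 * (\<alpha> \<bullet> generic_parameters) = of_int (n 1 * 12 + n 2 * 15 + n 3 * 10 + n 4 * 24)" .
    \<comment> \<open>Only the term with 15 is odd, since \<open>n 2\<close> is odd; hence the sum
      is odd.\<close>
    moreover have "\<not> 60 dvd n 1 * 12 + n 2 * 15 + n 3 * 10 + n 4 * 24"
      using n(2)[of 2] by presburger
    ultimately show ?thesis by (rule not_Ints_if_not_multiple)
  qed
qed

theorem theoremB:
  "\<exists>(\<theta> :: real^4) (D :: complex set) (y :: complex \<Rightarrow> complex).
     PVI_solution_on \<theta> D y \<and>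
     algebraic_function_on D y \<and>
     \<theta> \<notin> \<Union> affine_F4_hyperplanes \<and>
     \<theta> \<notin> \<Union> affine_D4_hyperplanes \<and>
     (\<forall>\<alpha>\<in>F4_roots. \<alpha> \<bullet> \<theta> \<notin> \<int>)"
proof -
  have t_par'_nonzero: "t_par' s \<noteq> 0" if "s \<in> regular" for s
    using that by (auto simp: regular_def t_par'_def)
  obtain D y where D: "open D" "connected D" "D \<noteq> {}" "y holomorphic_on D"
    and par: "\<And>t. t \<in> D \<Longrightarrow>
      \<exists>s\<in>regular. t = t_par s \<and> y t = y_par s \<and> deriv y t = dydt s \<and> deriv (deriv y) t = d2ydt2 s"
    using local_parametrization[OF open_regular three_in_regular t_par_deriv y_par_deriv dydt_deriv
        t_par'_nonzero] by metis
  have "t \<noteq> 0 \<and> t \<noteq> 1 \<and> y t \<noteq> 0 \<and> y t \<noteq> 1 \<and> y t \<noteq> t \<and>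
      deriv (deriv y) t = PVI_rhs (1/50) (-2/25) (1/18) (3/8) t (y t) (deriv y t)" if tD: "t \<in> D" for t
  proof -
    obtain s where s: "s \<in> regular" "t = t_par s" "y t = y_par s" "deriv y t = dydt s"
        "deriv (deriv y) t = d2ydt2 s"
      using par[OF tD] by blast
    \<comment> \<open>The conditions \<open>t \<noteq> 1\<close>, \<open>y \<noteq> 1\<close> and
      \<open>y \<noteq> t\<close> are put as nonvanishing differences so that the factorizations
      apply.\<close>
    have "t_par s \<noteq> 0" "y_par s \<noteq> 0" "t_par s - 1 \<noteq> 0" "y_par s - 1 \<noteq> 0" "y_par s - t_par s \<noteq> 0"
      unfolding t_par_minus_1[OF s(1)] y_par_minus_1[OF s(1)] y_par_minus_t_par[OF s(1)]
      unfolding t_par_def y_par_def using s(1) by (simp_all add: regular_def)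
    then show ?thesis using PVI_par[OF s(1)] s by auto
  qed
  then have "PVI_solution_on generic_parameters D y"
    using D by (auto simp: PVI_solution_on_def power2_eq_square)
  moreover have "algebraic_function_on D y"
  proof -
    \<comment> \<open>The factors are recast as formal polynomials, constant coefficient first, to
      make \<open>t\<close> and \<open>y\<close> quotients whose denominators do not vanish on
      \<open>regular\<close>.\<close>
    let ?a = "[:1, 0, 1:] :: complex poly" and ?b = "[:- 4, 3:] :: complex poly"
      and ?c = "[:- 1, 2:] :: complex poly" and ?d = "[:4, 0, 9:] :: complex poly"
    define n1 where "n1 = smult 27 ([:0, 1:] ^ 5 * ?a ^ 2 * ?b ^ 3)"
    define d1 where "d1 = smult 4 (?c ^ 3 * ?d ^ 2)"
    define n2 where "n2 = smult (- 9) ([:0, 1:] * ?a * ?b * [:2, -3, 3, -5, 15:])"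
    define d2 where "d2 = ?c ^ 2 * ?d * [:10, 3, 9:]"
    have evals: "poly ?a s = pa s" "poly ?b s = pb s" "poly ?c s = pc s" "poly ?d s = pd s"
        "poly [:2, -3, 3, -5, 15:] s = pq s" "poly [:10, 3, 9:] s = pe s" for s
      by (simp_all add: factor_defs algebra_simps power2_eq_square power3_eq_cube power4_eq_xxxx)
    have t_eval: "t_par s = poly n1 s / poly d1 s" for s
      unfolding n1_def d1_def poly_smult poly_mult poly_power evals by (simp add: t_par_def mult.assoc)
    have y_eval: "y_par s = poly n2 s / poly d2 s" for s
      unfolding n2_def d2_def poly_smult poly_mult poly_power evals by (simp add: y_par_def mult.assoc)
    have "poly d1 s \<noteq> 0 \<and> poly d2 s \<noteq> 0" if "s \<in> regular" for s
      unfolding d1_def d2_def poly_smult poly_mult poly_power evals using that by (simp add: regular_def)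
    moreover obtain F :: "complex poly poly" where "F \<noteq> 0"
      "\<And>s. poly d1 s \<noteq> 0 \<Longrightarrow> poly d2 s \<noteq> 0 \<Longrightarrow>
         poly (poly F [:poly n2 s / poly d2 s:]) (poly n1 s / poly d1 s) = 0"
      using rational_functions_algebraically_dependent[of d1 d2 n2 n1] by blast
    ultimately have "poly (poly F [:y_par s:]) (t_par s) = 0" if "s \<in> regular" for s
      using that by (simp add: t_eval y_eval)
    then have "\<forall>t\<in>D. poly (poly F [:y t:]) t = 0"
      using par by metis
    with \<open>F \<noteq> 0\<close> show ?thesis
      unfolding algebraic_function_on_def by blast
  qed
  moreover have "F4_short_roots \<subseteq> F4_roots" by (simp add: F4_roots_def)
  then have "generic_parameters \<notin> \<Union> affine_F4_hyperplanes" "generic_parameters \<notin> \<Union> affine_D4_hyperplanes"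
    using generic_parameters_off_roots
    by (force simp: affine_F4_hyperplanes_def affine_D4_hyperplanes_def root_hyperplane_def)+
  ultimately show ?thesis using generic_parameters_off_roots by blast
qed

end
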